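(* Let $P_n$ be a path of order $n$, with vertices labelled consecutively $a_1,a_2,\dots,a_n$, so that $a_1$ and $a_n$ are the end vertices. Then for $1\le i\le n$: $$d_d(a_i)=\begin{cases}\lceil n/3\rceil \text{ or } \lceil n/3\rceil+1 & \text{for } n=3k,\\ \lceil n/3\rceil & \text{for } n=3k+1,\\ \lceil n/3\rceil \text{ or } \lceil n/3\rceil+1 & \text{for } n=3k+2.\end{cases}$$ Moreover, for $n=3k$: $d_d(a_i)=\lceil n/3\rceil$ if $i=3j+2$ for some integer $j\le k$, and $d_d(a_i)=\lceil n/3\rceil+1$ if $i=3j+1$ or $i=3j$ for some integer $j\le k$. For $n=3k+2$: $d_d(a_i)=\lceil n/3\rceil$ if $i=3j+t$ with $t\in\{1,2\}$ and some integer $j\le k$, and $d_d(a_i)=\lceil n/3\rceil+1$ if $i=3j$ for some integer $j\le k$.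
   Context: A dominating set of a finite simple graph $G$ is a set $D\subseteq V(G)$ such that every vertex in $V(G)\setminus D$ is adjacent to some vertex of $D$. A minimal dominating set is a dominating set that does not properly contain any other dominating set. The domination degree of a vertex $a$ is $d_d(a)=\min\{|D| : D \text{ is a minimal dominating set of } G \text{ with } a\in D\}$. The order of a graph is its number of vertices. Here $n\ge 1$, $k$ and $j$ are nonnegative integers, and in every case $i$ ranges over indices with $1\le i\le n$. *)

theory Defs
  imports Complex_Main "Graph_Theory.Digraph"
begin

text \<open>
  A finite simple graph is a digraph satisfying \<^locale>\<open>graph\<close>: finite, loop-free,
  without parallel arcs, and symmetric. Each undirected edge is a pair of opposite arcs.
\<close>

definition dominating_set :: "('a,'b) pre_digraph \<Rightarrow> 'a set \<Rightarrow> bool" where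
  "dominating_set G D \<longleftrightarrow>
     D \<subseteq> verts G \<and> (\<forall>v \<in> verts G - D. \<exists>u \<in> D. v \<rightarrow>\<^bsub>G\<^esub> u)"

definition minimal_dominating_set :: "('a,'b) pre_digraph \<Rightarrow> 'a set \<Rightarrow> bool" where
  "minimal_dominating_set G D \<longleftrightarrow>
     dominating_set G D \<and> (\<forall>D'. dominating_set G D' \<longrightarrow> \<not> D' \<subset> D)"

text \<open>
  In a finite simple graph, the set below is finite, and it is nonempty for every vertex
  \<open>v\<close>: extend \<open>{v}\<close> to a maximal independent set.
\<close>

definition domination_degree :: "('a,'b) pre_digraph \<Rightarrow> 'a \<Rightarrow> nat" where
  "domination_degree G v = Min {card D | D. minimal_dominating_set G D \<and> v \<in> D}"

definition labelled_path :: "nat \<Rightarrow> (nat \<Rightarrow> 'a) \<Rightarrow> ('a,'b) pre_digraph \<Rightarrow> bool" where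
  "labelled_path n a G \<longleftrightarrow>
     graph G \<and> bij_betw a {1..n} (verts G) \<and>
     arcs_ends G = {(a i, a j) | i j. i \<in> {1..n} \<and> j \<in> {1..n} \<and> (j = i + 1 \<or> i = j + 1)}"

end

theory Submission
  imports Defs
begin

text \<open>
  On a path the trichotomy collapses to one closed formula,
  \<open>d\<^sub>d(a\<^sub>i) = 1 + i div 3 + (n + 1 - i) div 3\<close>; the cases of the theorem are this formula read
  modulo 3.

  For the lower bound, split a dominating set containing \<open>a\<^sub>i\<close> at \<open>i\<close>. A member to the right of
  \<open>i\<close> reaches no further left than \<open>i\<close>, and \<open>i\<close> itself no further than \<open>i - 1\<close>, so the
  vertices \<open>1, \<dots>, i - 2\<close> are dominated from the left part alone. One vertex dominates at most
  three, which forces at least \<open>\<lceil>(i - 2) / 3\<rceil> = i div 3\<close> members there; the right part is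
  symmetric (\<open>dominating_index_set_card_ge\<close>).

  For the upper bound, start at \<open>i\<close> and take every third vertex in both directions. If an end
  vertex stays undominated, the next step would fall just one place outside the path; pull it
  back onto that end (\<open>third_steps\<close>). The resulting set is dominating and has the right size.
  It is also independent, and independence makes any dominating set minimal: a removed vertex
  would have to be dominated by another member
  (\<open>independent_dominating_set_is_minimal\<close>). Minimality thus needs no separate search for
  private neighbours, not even for \<open>a\<^sub>i\<close>.
\<close>

section \<open>Domination on a path in terms of indices\<close>

lemma independent_dominating_set_is_minimal:
  assumes "dominating_set G D"
    and "\<And>u v. u \<in> D \<Longrightarrow> v \<in> D \<Longrightarrow> \<not> u \<rightarrow>\<^bsub>G\<^esub> v"
  shows "minimal_dominating_set G D"
  using assms unfolding minimal_dominating_set_def dominating_set_def by blast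

lemma labelled_path_adjacent_iff:
  assumes "labelled_path n a G" "i \<in> {1..n}" "j \<in> {1..n}"
  shows "a i \<rightarrow>\<^bsub>G\<^esub> a j \<longleftrightarrow> j = i + 1 \<or> i = j + 1"
proof -
  have inj: "inj_on a {1..n}"
    and arcs: "arcs_ends G = {(a i, a j) | i j.
      i \<in> {1..n} \<and> j \<in> {1..n} \<and> (j = i + 1 \<or> i = j + 1)}"
    using assms(1) by (auto simp: labelled_path_def bij_betw_def)
  show ?thesis
  proof
    assume "a i \<rightarrow>\<^bsub>G\<^esub> a j"
    then obtain i' j' where "a i = a i'" "a j = a j'" "i' \<in> {1..n}" "j' \<in> {1..n}"
      and adj: "j' = i' + 1 \<or> i' = j' + 1"
      unfolding arcs by blast
    then have "i = i'" "j = j'"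
      using inj_onD[OF inj] assms(2,3) by blast+
    with adj show "j = i + 1 \<or> i = j + 1" by simp
  qed (use assms(2,3) arcs in blast)
qed

definition dominating_index_set :: "nat \<Rightarrow> nat set \<Rightarrow> bool" where
  "dominating_index_set n S \<longleftrightarrow>
     S \<subseteq> {1..n} \<and> (\<forall>v \<in> {1..n}. \<exists>u \<in> S. v \<le> u + 1 \<and> u \<le> v + 1)"

lemma dominating_set_image_iff:
  assumes "labelled_path n a G" "S \<subseteq> {1..n}"
  shows "dominating_set G (a ` S) \<longleftrightarrow> dominating_index_set n S"
proof -
  have inj: "inj_on a {1..n}" and verts: "verts G = a ` {1..n}"
    using assms(1) by (auto simp: labelled_path_def bij_betw_def)
  have diff: "verts G - a ` S = a ` ({1..n} - S)"
    unfolding verts by (rule inj_on_image_set_diff[OF inj Diff_subset assms(2), symmetric])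
  have "dominating_set G (a ` S) \<longleftrightarrow> (\<forall>v \<in> {1..n} - S. \<exists>u \<in> S. a v \<rightarrow>\<^bsub>G\<^esub> a u)"
    using image_mono[OF assms(2), of a] unfolding dominating_set_def diff by (simp add: verts)
  also have "\<dots> \<longleftrightarrow> (\<forall>v \<in> {1..n} - S. \<exists>u \<in> S. u = v + 1 \<or> v = u + 1)"
    by (intro ball_cong bex_cong refl labelled_path_adjacent_iff[OF assms(1)])
      (use assms(2) in blast)+
  also have "\<dots> \<longleftrightarrow> dominating_index_set n S"
  proof
    assume dom: "\<forall>v \<in> {1..n} - S. \<exists>u \<in> S. u = v + 1 \<or> v = u + 1"
    have "\<exists>u \<in> S. v \<le> u + 1 \<and> u \<le> v + 1" if "v \<in> {1..n}" for v
    proof (cases "v \<in> S")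
      case True
      then show ?thesis by (intro bexI[of _ v]) auto
    next
      case False
      with dom that obtain u where "u \<in> S" "u = v + 1 \<or> v = u + 1" by blast
      then show ?thesis by (intro bexI[of _ u]) auto
    qed
    with assms(2) show "dominating_index_set n S"
      by (simp add: dominating_index_set_def)
  next
    assume dom: "dominating_index_set n S"
    show "\<forall>v \<in> {1..n} - S. \<exists>u \<in> S. u = v + 1 \<or> v = u + 1"
    proof
      fix v assume v: "v \<in> {1..n} - S"
      with dom obtain u where u: "u \<in> S" "v \<le> u + 1" "u \<le> v + 1"
        unfolding dominating_index_set_def by blast
      with v have "u \<noteq> v" by blast
      with u show "\<exists>u \<in> S. u = v + 1 \<or> v = u + 1" by (intro bexI[of _ u]) auto
    qed
  qed
  finally show ?thesis .
qed

section \<open>The lower bound\<close>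

text \<open>The volume bound: a closed neighbourhood on the path has at most three elements.\<close>

lemma card_le_three_times_near:
  fixes A S :: "nat set"
  assumes "finite S" "\<And>v. v \<in> A \<Longrightarrow> \<exists>u \<in> S. v \<le> u + 1 \<and> u \<le> v + 1"
  shows "card A \<le> 3 * card S"
proof -
  have "A \<subseteq> (\<Union>u \<in> S. {u - 1..u + 1})"
  proof
    fix v assume "v \<in> A"
    with assms(2) obtain u where "u \<in> S" "v \<le> u + 1" "u \<le> v + 1" by blast
    then show "v \<in> (\<Union>u \<in> S. {u - 1..u + 1})" by (intro UN_I[of u]) auto
  qed
  then have "card A \<le> card (\<Union>u \<in> S. {u - 1..u + 1})"
    by (intro card_mono) (use assms(1) in auto)
  also have "\<dots> \<le> (\<Sum>u \<in> S. card {u - 1..u + 1})"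
    by (rule card_UN_le[OF assms(1)])
  also have "\<dots> \<le> (\<Sum>u \<in> S. 3)"
    by (rule sum_mono) auto
  finally show ?thesis by simp
qed

text \<open>
  The vertices at distance at least 2 from \<open>i\<close> on one side can only be dominated from that
  side, so the volume bound applies to each side separately and the member \<open>i\<close> comes on top.
\<close>

lemma dominating_index_set_card_ge:
  assumes "dominating_index_set n S" "i \<in> S"
  shows "1 + i div 3 + (n + 1 - i) div 3 \<le> card S"
proof -
  define L where "L = {u \<in> S. u < i}"
  define R where "R = {u \<in> S. i < u}"
  have S: "S \<subseteq> {1..n}" and near: "\<And>v. v \<in> {1..n} \<Longrightarrow> \<exists>u \<in> S. v \<le> u + 1 \<and> u \<le> v + 1"
    using assms(1) by (auto simp: dominating_index_set_def)
  have i: "1 \<le> i" "i \<le> n" using S assms(2) by auto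
  have fin: "finite S" using S finite_subset by blast
  then have finLR: "finite L" "finite R" by (auto simp: L_def R_def)
  have "card {1..i - 2} \<le> 3 * card L"
  proof (rule card_le_three_times_near[OF finLR(1)])
    fix v assume v: "v \<in> {1..i - 2}"
    then have "v \<in> {1..n}" using i by auto
    with near obtain u where "u \<in> S" "v \<le> u + 1" "u \<le> v + 1" by blast
    with v show "\<exists>u \<in> L. v \<le> u + 1 \<and> u \<le> v + 1"
      by (intro bexI[of _ u]) (auto simp: L_def)
  qed
  moreover have "card {i + 2..n} \<le> 3 * card R"
  proof (rule card_le_three_times_near[OF finLR(2)])
    fix v assume v: "v \<in> {i + 2..n}"
    then have "v \<in> {1..n}" by auto
    with near obtain u where "u \<in> S" "v \<le> u + 1" "u \<le> v + 1" by blast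
    with v show "\<exists>u \<in> R. v \<le> u + 1 \<and> u \<le> v + 1"
      by (intro bexI[of _ u]) (auto simp: R_def)
  qed
  moreover have "card S = 1 + card L + card R"
  proof -
    have "S = insert i (L \<union> R)" "i \<notin> L \<union> R" "L \<inter> R = {}"
      using assms(2) by (auto simp: L_def R_def)
    then show ?thesis using finLR by (simp add: card_Un_disjoint)
  qed
  \<comment> \<open>\<open>i div 3\<close> is the ceiling of \<open>(i - 2) / 3\<close>; likewise on the right.\<close>
  moreover have "i div 3 \<le> l" if "i - 2 \<le> 3 * l" for l
    using that by linarith
  moreover have "(n + 1 - i) div 3 \<le> r" if "n - (i + 1) \<le> 3 * r" for r
    using that i(2) by linarith
  ultimately show ?thesis by (simp add: add_mono)
qed

section \<open>An independent dominating set through a given vertex\<close>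

text \<open>
  The truncation by \<open>max\<close> and \<open>min\<close> acts only on the last step of each direction. The ranges
  of \<open>q\<close> allow that step to overshoot, but by one place at most (to \<open>0\<close> or to \<open>n + 1\<close>), and it
  does so precisely when the regular steps leave the end vertex undominated.
\<close>

definition third_steps :: "nat \<Rightarrow> nat \<Rightarrow> nat set" where
  "third_steps n i = insert i
     ((\<lambda>q. max 1 (i - 3 * q)) ` {1..i div 3} \<union>
      (\<lambda>q. min n (i + 3 * q)) ` {1..(n + 1 - i) div 3})"

lemma third_steps_card_le: "card (third_steps n i) \<le> 1 + i div 3 + (n + 1 - i) div 3"
proof -
  let ?L = "(\<lambda>q. max 1 (i - 3 * q)) ` {1..i div 3}"
  let ?R = "(\<lambda>q. min n (i + 3 * q)) ` {1..(n + 1 - i) div 3}"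
  have "card ?L \<le> i div 3" "card ?R \<le> (n + 1 - i) div 3"
    by (rule order_trans[OF card_image_le]; simp)+
  moreover have "card (third_steps n i) \<le> Suc (card (?L \<union> ?R))"
    unfolding third_steps_def by (simp add: card_insert_if)
  ultimately show ?thesis
    using card_Un_le[of ?L ?R] by linarith
qed

text \<open>
  A member off the residue class of \<open>i\<close> is an end vertex that was pulled back, and pulling
  it back by one place fixes the residue of \<open>i\<close>. Members in adjacent places would contradict
  these residues or the bounds on \<open>i\<close>, hence independence.
\<close>

lemma third_steps_cases:
  assumes "i \<in> {1..n}" "x \<in> third_steps n i"
  shows "x \<in> {1..n}"
    and "x mod 3 = i mod 3 \<or> x = 1 \<and> i mod 3 = 0 \<or> x = n \<and> (n + 1) mod 3 = i mod 3"
proof -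
  consider "x = i" | q where "1 \<le> q" "q \<le> i div 3" "x = max 1 (i - 3 * q)"
    | q where "1 \<le> q" "q \<le> (n + 1 - i) div 3" "x = min n (i + 3 * q)"
    using assms(2) by (auto simp: third_steps_def)
  then have "x \<in> {1..n} \<and>
    (x mod 3 = i mod 3 \<or> x = 1 \<and> i mod 3 = 0 \<or> x = n \<and> (n + 1) mod 3 = i mod 3)"
  proof cases
    case 1
    then show ?thesis using assms(1) by simp
  next
    case 2
    then have "i = 3 * q \<and> x = 1 \<or> i = x + 3 * q \<and> 1 \<le> x" by linarith
    then show ?thesis using assms(1) by auto
  next
    case 3
    then have "i + 3 * q = n + 1 \<and> x = n \<or> x = i + 3 * q \<and> x \<le> n"
      using assms(1) by auto
    moreover have "(n + 1) mod 3 = i mod 3" if "i + 3 * q = n + 1"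
      using that by (metis mod_mult_self2)
    ultimately show ?thesis using assms(1) by auto
  qed
  then show "x \<in> {1..n}"
    and "x mod 3 = i mod 3 \<or> x = 1 \<and> i mod 3 = 0 \<or> x = n \<and> (n + 1) mod 3 = i mod 3"
    by blast+
qed

lemma third_steps_independent:
  assumes "i \<in> {1..n}" "x \<in> third_steps n i" "y \<in> third_steps n i"
  shows "y \<noteq> x + 1"
proof
  assume y: "y = x + 1"
  have bounds: "1 \<le> x" "y \<le> n" "1 \<le> i" "i \<le> n"
    using third_steps_cases(1)[OF assms(1,2)] third_steps_cases(1)[OF assms(1,3)] assms(1)
    by auto
  have "x mod 3 = i mod 3 \<or> x = 1 \<and> i mod 3 = 0"
    using third_steps_cases(2)[OF assms(1,2)] bounds y by auto
  moreover have "(x + 1) mod 3 = i mod 3 \<or> x + 1 = n \<and> (x + 2) mod 3 = i mod 3"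
    using third_steps_cases(2)[OF assms(1,3)] bounds y by auto
  moreover have "(x + 1) mod 3 \<noteq> x mod 3" "(x + 2) mod 3 \<noteq> x mod 3"
    by presburger+
  \<comment> \<open>The residues leave only two pulled-back ends that are neighbours.\<close>
  ultimately have "x = 1" "i mod 3 = 0" "n = 2" by auto
  moreover from this have "i = 1 \<or> i = 2" using bounds(3,4) by linarith
  ultimately show False by auto
qed

lemma third_steps_dominating:
  assumes "i \<in> {1..n}"
  shows "dominating_index_set n (third_steps n i)"
  unfolding dominating_index_set_def
proof (intro conjI ballI)
  show "third_steps n i \<subseteq> {1..n}" using third_steps_cases(1)[OF assms] by blast
next
  fix v assume v: "v \<in> {1..n}"
  show "\<exists>u \<in> third_steps n i. v \<le> u + 1 \<and> u \<le> v + 1"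
  proof (cases "v \<le> i")
    case True
    \<comment> \<open>The number of steps of length 3 whose total is nearest to the distance from \<open>i\<close>.\<close>
    define q where "q = (i - v + 1) div 3"
    have q: "i - v \<le> 3 * q + 1" "3 * q \<le> i - v + 1"
      unfolding q_def by presburger+
    have "max 1 (i - 3 * q) \<in> third_steps n i"
    proof (cases "q = 0")
      case False
      moreover have "q \<le> i div 3" using q(2) v True by auto
      ultimately show ?thesis by (auto simp: third_steps_def)
    qed (use assms in \<open>simp add: third_steps_def max_def\<close>)
    moreover have "v \<le> max 1 (i - 3 * q) + 1" "max 1 (i - 3 * q) \<le> v + 1"
      using q v True by auto
    ultimately show ?thesis by blast
  next
    case False
    define q where "q = (v - i + 1) div 3"
    have q: "v - i \<le> 3 * q + 1" "3 * q \<le> v - i + 1"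
      unfolding q_def by presburger+
    have "min n (i + 3 * q) \<in> third_steps n i"
    proof (cases "q = 0")
      case False
      moreover have "q \<le> (n + 1 - i) div 3" using q(2) v \<open>\<not> v \<le> i\<close> by auto
      ultimately show ?thesis by (auto simp: third_steps_def)
    qed (use assms in \<open>simp add: third_steps_def min_def\<close>)
    moreover have "v \<le> min n (i + 3 * q) + 1" "min n (i + 3 * q) \<le> v + 1"
      using q v False by auto
    ultimately show ?thesis by blast
  qed
qed

section \<open>The domination degree\<close>

lemma domination_degree_path:
  assumes "labelled_path n a G" "i \<in> {1..n}"
  shows "domination_degree G (a i) = 1 + i div 3 + (n + 1 - i) div 3"
proof -
  let ?d = "1 + i div 3 + (n + 1 - i) div 3"
  let ?C = "{card D | D. minimal_dominating_set G D \<and> a i \<in> D}"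
  have inj: "inj_on a {1..n}" and verts: "verts G = a ` {1..n}"
    using assms(1) by (auto simp: labelled_path_def bij_betw_def)
  have lower: "?d \<le> card D \<and> card D \<le> n" if D: "minimal_dominating_set G D" "a i \<in> D" for D
  proof -
    have dom: "dominating_set G D" using D(1) by (simp add: minimal_dominating_set_def)
    then obtain S where S: "S \<subseteq> {1..n}" "D = a ` S"
      unfolding dominating_set_def verts by (meson subset_imageE)
    have "i \<in> S" using inj_on_image_mem_iff[OF inj assms(2) S(1)] D(2) S(2) by simp
    moreover have "dominating_index_set n S"
      using dom dominating_set_image_iff[OF assms(1) S(1)] S(2) by simp
    ultimately have "?d \<le> card S" by (intro dominating_index_set_card_ge)
    moreover have "card D = card S"
      using S inj by (simp add: card_image inj_on_subset)
    moreover have "card S \<le> n" using card_mono[OF _ S(1)] by simp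
    ultimately show ?thesis by simp
  qed
  let ?T = "third_steps n i"
  have T: "?T \<subseteq> {1..n}" "i \<in> ?T"
    by (rule subsetI, erule third_steps_cases(1)[OF assms(2)]) (simp add: third_steps_def)
  have "minimal_dominating_set G (a ` ?T)"
  proof (rule independent_dominating_set_is_minimal)
    show "dominating_set G (a ` ?T)"
      using dominating_set_image_iff[OF assms(1) T(1)] third_steps_dominating[OF assms(2)]
      by simp
  next
    fix u v assume "u \<in> a ` ?T" "v \<in> a ` ?T"
    then obtain x y where "x \<in> ?T" "y \<in> ?T" and [simp]: "u = a x" "v = a y" by blast
    moreover from this have "x \<in> {1..n}" "y \<in> {1..n}" using T(1) by blast+
    ultimately show "\<not> u \<rightarrow>\<^bsub>G\<^esub> v"
      using third_steps_independent[OF assms(2)]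
      by (simp add: labelled_path_adjacent_iff[OF assms(1)])
  qed
  moreover have "a i \<in> a ` ?T" using T(2) by blast
  moreover have "card (a ` ?T) \<le> ?d"
    using third_steps_card_le[of n i] T(1) inj by (simp add: card_image inj_on_subset)
  ultimately have "minimal_dominating_set G (a ` ?T) \<and> a i \<in> a ` ?T \<and> ?d = card (a ` ?T)"
    using lower[of "a ` ?T"] by linarith
  then have "?d \<in> ?C" by blast
  moreover have "finite ?C" using lower by (intro finite_subset[of ?C "{..n}"]) auto
  moreover have "?d \<le> c" if "c \<in> ?C" for c using that lower by blast
  ultimately show ?thesis
    unfolding domination_degree_def by (intro Min_eqI)
qed

text \<open>
  Rounding the two sides of \<open>i\<close> separately costs at most one vertex over rounding the whole
  path; the residues of the path length and of the position decide whether it does.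
\<close>

lemma split_thirds:
  fixes i p :: nat
  shows "1 + i div 3 + (p + 1) div 3 = (i + p + 2) div 3 +
    (if (i + p) mod 3 = 0 \<and> i mod 3 \<noteq> 2 \<or> (i + p) mod 3 = 2 \<and> i mod 3 = 0 then 1 else 0)"
proof -
  define q r s t where "q = i div 3" and "r = i mod 3" and "s = p div 3" and "t = p mod 3"
  have i: "i = r + 3 * q" and p: "p = t + 3 * s"
    by (simp_all add: q_def r_def s_def t_def)
  have quot: "(i + p + 2) div 3 = q + s + (r + t + 2) div 3" "(p + 1) div 3 = s + (t + 1) div 3"
    using div_mult_self2[of 3 "r + t + 2" "q + s"] div_mult_self2[of 3 "t + 1" s]
    by (simp_all add: i p algebra_simps)
  have rem: "(i + p) mod 3 = (r + t) mod 3"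
    unfolding r_def t_def by (simp add: mod_add_eq)
  have "r \<in> {0, 1, 2}" "t \<in> {0, 1, 2}"
    unfolding r_def t_def by auto
  then show ?thesis
    unfolding quot rem q_def[symmetric] r_def[symmetric] by auto
qed

lemma domination_degree_path_ceiling:
  assumes "labelled_path n a G" "i \<in> {1..n}"
  shows "int (domination_degree G (a i)) = \<lceil>real n / 3\<rceil> +
    (if n mod 3 = 0 \<and> i mod 3 \<noteq> 2 \<or> n mod 3 = 2 \<and> i mod 3 = 0 then 1 else 0)"
proof -
  have "i + (n - i) = n" "n + 1 - i = n - i + 1" using assms(2) by auto
  then have "domination_degree G (a i) = (n + 2) div 3 +
      (if n mod 3 = 0 \<and> i mod 3 \<noteq> 2 \<or> n mod 3 = 2 \<and> i mod 3 = 0 then 1 else 0)"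
    using domination_degree_path[OF assms] split_thirds[of i "n - i"] by simp
  moreover have "\<lceil>real n / 3\<rceil> = int ((n + 2) div 3)" by linarith
  ultimately show ?thesis by simp
qed

theorem theorem3p17:
  fixes G :: "('a,'b) pre_digraph" and a :: "nat \<Rightarrow> 'a" and n :: nat
  assumes "n \<ge> 1" and "labelled_path n a G"
  shows
    "(\<forall>k. n = 3 * k \<longrightarrow> (\<forall>i \<in> {1..n}.
        int (domination_degree G (a i)) = \<lceil>real n / 3\<rceil> \<or>
        int (domination_degree G (a i)) = \<lceil>real n / 3\<rceil> + 1)) \<and>
     (\<forall>k. n = 3 * k + 1 \<longrightarrow> (\<forall>i \<in> {1..n}.
        int (domination_degree G (a i)) = \<lceil>real n / 3\<rceil>)) \<and>
     (\<forall>k. n = 3 * k + 2 \<longrightarrow> (\<forall>i \<in> {1..n}.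
        int (domination_degree G (a i)) = \<lceil>real n / 3\<rceil> \<or>
        int (domination_degree G (a i)) = \<lceil>real n / 3\<rceil> + 1)) \<and>
     (\<forall>k. n = 3 * k \<longrightarrow> (\<forall>i \<in> {1..n}.
        ((\<exists>j\<le>k. i = 3 * j + 2) \<longrightarrow>
           int (domination_degree G (a i)) = \<lceil>real n / 3\<rceil>) \<and>
        ((\<exists>j\<le>k. i = 3 * j + 1 \<or> i = 3 * j) \<longrightarrow>
           int (domination_degree G (a i)) = \<lceil>real n / 3\<rceil> + 1))) \<and>
     (\<forall>k. n = 3 * k + 2 \<longrightarrow> (\<forall>i \<in> {1..n}.
        ((\<exists>j\<le>k. \<exists>t \<in> {1, 2}. i = 3 * j + t) \<longrightarrow>
           int (domination_degree G (a i)) = \<lceil>real n / 3\<rceil>) \<and>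
        ((\<exists>j\<le>k. i = 3 * j) \<longrightarrow>
           int (domination_degree G (a i)) = \<lceil>real n / 3\<rceil> + 1)))"
proof -
  note deg = domination_degree_path_ceiling[OF assms(2)]
  have res: "(3 * j) mod 3 = 0" "(3 * j + 1) mod 3 = 1" "(3 * j + 2) mod 3 = 2" for j :: nat
    by presburger+
  show ?thesis
  proof (intro conjI allI impI ballI)
    fix k i assume n: "n = 3 * k" and i: "i \<in> {1..n}"
    have "n mod 3 = 0" unfolding n by (rule res)
    with deg[OF i] have v: "int (domination_degree G (a i)) =
        \<lceil>real n / 3\<rceil> + (if i mod 3 = 2 then 0 else 1)"
      by simp
    show "int (domination_degree G (a i)) = \<lceil>real n / 3\<rceil> \<or>
        int (domination_degree G (a i)) = \<lceil>real n / 3\<rceil> + 1"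
      unfolding v by simp
    show "int (domination_degree G (a i)) = \<lceil>real n / 3\<rceil>" if "\<exists>j\<le>k. i = 3 * j + 2"
      unfolding v using that res(3) by auto
    show "int (domination_degree G (a i)) = \<lceil>real n / 3\<rceil> + 1"
      if "\<exists>j\<le>k. i = 3 * j + 1 \<or> i = 3 * j"
      unfolding v using that res(1,2) by auto
  next
    fix k i assume n: "n = 3 * k + 1" and i: "i \<in> {1..n}"
    have "n mod 3 = 1" unfolding n by (rule res)
    with deg[OF i] show "int (domination_degree G (a i)) = \<lceil>real n / 3\<rceil>" by simp
  next
    fix k i assume n: "n = 3 * k + 2" and i: "i \<in> {1..n}"
    have "n mod 3 = 2" unfolding n by (rule res)
    with deg[OF i] have v: "int (domination_degree G (a i)) =
        \<lceil>real n / 3\<rceil> + (if i mod 3 = 0 then 1 else 0)"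
      by simp
    show "int (domination_degree G (a i)) = \<lceil>real n / 3\<rceil> \<or>
        int (domination_degree G (a i)) = \<lceil>real n / 3\<rceil> + 1"
      unfolding v by simp
    show "int (domination_degree G (a i)) = \<lceil>real n / 3\<rceil>"
      if "\<exists>j\<le>k. \<exists>t \<in> {1, 2}. i = 3 * j + t"
      unfolding v using that res(2,3) by auto
    show "int (domination_degree G (a i)) = \<lceil>real n / 3\<rceil> + 1" if "\<exists>j\<le>k. i = 3 * j"
      unfolding v using that res(1) by auto
  qed
qed

end
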